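(* Let $n$ be a positive integer and let $R_n=\mathbb{Z}_n$ be the dihedral quandle with the operation $i*j=2j-i \pmod n$. Then the automorphism group $\mathrm{Aut}(R_n)$ is isomorphic to the affine group $\mathrm{Aff}(\mathbb{Z}_n)$.
   Context: $\mathbb{Z}_n$ denotes the integers modulo $n$ and $\mathbb{Z}_n^{\times}$ its group of units. A quandle is a set $X$ with a binary operation $*$ such that: (1) $a*a=a$ for all $a\in X$; (2) for all $a,b\in X$ there is a unique $x\in X$ with $a=x*b$; (3) $(a*b)*c=(a*c)*(b*c)$ for all $a,b,c\in X$. The dihedral quandle $R_n$ is the set $\mathbb{Z}_n$ with $i*j=2j-i$ in $\mathbb{Z}_n$. A quandle homomorphism $f:(X,* )\to(Y,\vartriangleright)$ is a map with $f(a*b)=f(a)\vartriangleright f(b)$ for all $a,b\in X$; $\mathrm{Aut}(X)$ is the group (under composition) of bijective quandle homomorphisms $X\to X$. The affine group $\mathrm{Aff}(\mathbb{Z}_n)$ is the group under composition of the maps $f_{a,b}:\mathbb{Z}_n\to\mathbb{Z}_n$, $f_{a,b}(x)=ax+b$, with $a\in\mathbb{Z}_n^{\times}$ and $b\in\mathbb{Z}_n$ (equivalently, the semidirect product $\mathbb{Z}_n\rtimes\mathbb{Z}_n^{\times}$). *)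

theory Defs
  imports "HOL-Algebra.Bij" "HOL-Algebra.IntRing"
begin

record 'a quandle_structure = "'a partial_object" +
  qop :: "'a \<Rightarrow> 'a \<Rightarrow> 'a"  (infixl \<open>\<triangleright>\<index>\<close> 70)

locale quandle =
  fixes Q :: "('a, 'm) quandle_structure_scheme" (structure)
  assumes closed: "\<lbrakk>a \<in> carrier Q; b \<in> carrier Q\<rbrakk> \<Longrightarrow> a \<triangleright> b \<in> carrier Q"
    and idem: "a \<in> carrier Q \<Longrightarrow> a \<triangleright> a = a"
    and right_div: "\<lbrakk>a \<in> carrier Q; b \<in> carrier Q\<rbrakk> \<Longrightarrow> \<exists>!x. x \<in> carrier Q \<and> a = x \<triangleright> b"
    and self_distrib: "\<lbrakk>a \<in> carrier Q; b \<in> carrier Q; c \<in> carrier Q\<rbrakk>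
      \<Longrightarrow> (a \<triangleright> b) \<triangleright> c = (a \<triangleright> c) \<triangleright> (b \<triangleright> c)"

definition quandle_hom ::
  "('a, 'm) quandle_structure_scheme \<Rightarrow> ('b, 'n) quandle_structure_scheme \<Rightarrow> ('a \<Rightarrow> 'b) set" where
  "quandle_hom Q Q' = {f \<in> carrier Q \<rightarrow> carrier Q'.
     \<forall>a\<in>carrier Q. \<forall>b\<in>carrier Q. f (a \<triangleright>\<^bsub>Q\<^esub> b) = f a \<triangleright>\<^bsub>Q'\<^esub> f b}"

text \<open>As in \<^const>\<open>AutoGroup\<close>, maps on the carrier are represented by extensional functions
  (\<^const>\<open>Bij\<close>), and the multiplication is composition.\<close>

definition quandle_Aut :: "('a, 'm) quandle_structure_scheme \<Rightarrow> ('a \<Rightarrow> 'a) monoid" where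
  "quandle_Aut Q = BijGroup (carrier Q) \<lparr>carrier := quandle_hom Q Q \<inter> Bij (carrier Q)\<rparr>"

text \<open>The ring \<open>\<int>/n\<close> is the quotient \<^term>\<open>ZFact n\<close> rather than \<open>residue_ring n\<close>, since
  the latter is not a ring for \<open>n = 1\<close> (its unit element is then outside the carrier).\<close>

definition dihedral_quandle :: "nat \<Rightarrow> int set quandle_structure" where
  "dihedral_quandle n = \<lparr>carrier = carrier (ZFact (int n)),
     qop = \<lambda>i j. ([(2::nat)] \<cdot>\<^bsub>ZFact (int n)\<^esub> j) \<ominus>\<^bsub>ZFact (int n)\<^esub> i\<rparr>"

definition affine_map :: "('a, 'm) ring_scheme \<Rightarrow> 'a \<Rightarrow> 'a \<Rightarrow> 'a \<Rightarrow> 'a" where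
  "affine_map R a b = (\<lambda>x\<in>carrier R. (a \<otimes>\<^bsub>R\<^esub> x) \<oplus>\<^bsub>R\<^esub> b)"

definition affine_group :: "('a, 'm) ring_scheme \<Rightarrow> ('a \<Rightarrow> 'a) monoid" where
  "affine_group R = BijGroup (carrier R)
     \<lparr>carrier := {affine_map R a b | a b. a \<in> Units R \<and> b \<in> carrier R}\<rparr>"

lemma (in quandle) group_quandle_Aut: "group (quandle_Aut Q)"
proof -
  have op: "(\<triangleright>) \<in> carrier Q \<rightarrow> carrier Q \<rightarrow> carrier Q"
    using closed by auto
  have "subgroup (quandle_hom Q Q \<inter> Bij (carrier Q)) (BijGroup (carrier Q))"
  proof (rule group.subgroupI [OF group_BijGroup])
    show "quandle_hom Q Q \<inter> Bij (carrier Q) \<subseteq> carrier (BijGroup (carrier Q))"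
      by (auto simp: BijGroup_def)
    have "(\<lambda>x\<in>carrier Q. x) \<in> quandle_hom Q Q \<inter> Bij (carrier Q)"
      by (auto simp: quandle_hom_def id_Bij closed)
    then show "quandle_hom Q Q \<inter> Bij (carrier Q) \<noteq> {}" by blast
  next
    fix f assume f: "f \<in> quandle_hom Q Q \<inter> Bij (carrier Q)"
    have "inv_into (carrier Q) f (a \<triangleright> b) = inv_into (carrier Q) f a \<triangleright> inv_into (carrier Q) f b"
      if "a \<in> carrier Q" "b \<in> carrier Q" for a b
      by (rule Bij_inv_into_lemma) (use f op that in \<open>auto simp: quandle_hom_def\<close>)
    then show "inv\<^bsub>BijGroup (carrier Q)\<^esub> f \<in> quandle_hom Q Q \<inter> Bij (carrier Q)"
      using f by (auto simp: inv_BijGroup quandle_hom_def closed Bij_inv_into_mem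
          restrict_inv_into_Bij simp del: restrict_apply) (auto simp: closed Bij_inv_into_mem)
  next
    fix f g assume "f \<in> quandle_hom Q Q \<inter> Bij (carrier Q)" "g \<in> quandle_hom Q Q \<inter> Bij (carrier Q)"
    then show "f \<otimes>\<^bsub>BijGroup (carrier Q)\<^esub> g \<in> quandle_hom Q Q \<inter> Bij (carrier Q)"
      by (auto simp: BijGroup_def quandle_hom_def compose_Bij) 
         (auto simp: compose_def closed Pi_iff)
  qed
  then show ?thesis
    unfolding quandle_Aut_def by (rule subgroup.subgroup_is_group [OF _ group_BijGroup])
qed

lemma quandle_dihedral: "quandle (dihedral_quandle n)"
proof -
  interpret R: cring "ZFact (int n)" by (rule ZFact_is_cring)
  let ?R = "ZFact (int n)"
  have two: "[(2::nat)] \<cdot>\<^bsub>?R\<^esub> b = b \<oplus>\<^bsub>?R\<^esub> b" if "b \<in> carrier ?R" for b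
    using that by (simp add: numeral_2_eq_2 R.add.nat_pow_Suc)
  have invol: "b \<oplus>\<^bsub>?R\<^esub> b \<ominus>\<^bsub>?R\<^esub> (b \<oplus>\<^bsub>?R\<^esub> b \<ominus>\<^bsub>?R\<^esub> y) = y"
    if "y \<in> carrier ?R" "b \<in> carrier ?R" for y b
    using that by algebra
  show ?thesis
  proof (unfold_locales, goal_cases)
    case (3 a b)
    then have "a \<in> carrier ?R" "b \<in> carrier ?R" by (auto simp: dihedral_quandle_def)
    moreover from this have "a = b \<oplus>\<^bsub>?R\<^esub> b \<ominus>\<^bsub>?R\<^esub> x \<longleftrightarrow> x = b \<oplus>\<^bsub>?R\<^esub> b \<ominus>\<^bsub>?R\<^esub> a"
      if "x \<in> carrier ?R" for x
    proof -
      show ?thesis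
        using invol [of a b] invol [of x b] that \<open>a \<in> carrier ?R\<close> \<open>b \<in> carrier ?R\<close> by auto
    qed
    ultimately show ?case
      by (intro ex1I [of _ "b \<oplus>\<^bsub>?R\<^esub> b \<ominus>\<^bsub>?R\<^esub> a"]) (auto simp: dihedral_quandle_def two)
  next
    case (2 a)
    then have "a \<in> carrier ?R" by (simp add: dihedral_quandle_def)
    then have "a \<oplus>\<^bsub>?R\<^esub> a \<ominus>\<^bsub>?R\<^esub> a = a" by algebra
    with 2 show ?case by (simp add: dihedral_quandle_def two)
  next
    case (4 a b c)
    then have mem: "a \<in> carrier ?R" "b \<in> carrier ?R" "c \<in> carrier ?R"
      by (auto simp: dihedral_quandle_def)
    have "c \<oplus>\<^bsub>?R\<^esub> c \<ominus>\<^bsub>?R\<^esub> (b \<oplus>\<^bsub>?R\<^esub> b \<ominus>\<^bsub>?R\<^esub> a) =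
      c \<oplus>\<^bsub>?R\<^esub> c \<ominus>\<^bsub>?R\<^esub> b \<oplus>\<^bsub>?R\<^esub> (c \<oplus>\<^bsub>?R\<^esub> c \<ominus>\<^bsub>?R\<^esub> b) \<ominus>\<^bsub>?R\<^esub> (c \<oplus>\<^bsub>?R\<^esub> c \<ominus>\<^bsub>?R\<^esub> a)"
    proof -
      have "c \<oplus>\<^bsub>?R\<^esub> c \<ominus>\<^bsub>?R\<^esub> b \<oplus>\<^bsub>?R\<^esub> (c \<oplus>\<^bsub>?R\<^esub> c \<ominus>\<^bsub>?R\<^esub> b) \<ominus>\<^bsub>?R\<^esub> (c \<oplus>\<^bsub>?R\<^esub> c \<ominus>\<^bsub>?R\<^esub> a) =
        (c \<ominus>\<^bsub>?R\<^esub> b) \<oplus>\<^bsub>?R\<^esub> (c \<ominus>\<^bsub>?R\<^esub> b) \<oplus>\<^bsub>?R\<^esub> (c \<oplus>\<^bsub>?R\<^esub> c \<ominus>\<^bsub>?R\<^esub> (c \<oplus>\<^bsub>?R\<^esub> c \<ominus>\<^bsub>?R\<^esub> a))"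
        using mem by (simp add: a_minus_def R.minus_add R.add.m_ac)
      also have "\<dots> = (c \<ominus>\<^bsub>?R\<^esub> b) \<oplus>\<^bsub>?R\<^esub> (c \<ominus>\<^bsub>?R\<^esub> b) \<oplus>\<^bsub>?R\<^esub> a"
        using invol [of a c] mem by simp
      also have "\<dots> = c \<oplus>\<^bsub>?R\<^esub> c \<ominus>\<^bsub>?R\<^esub> (b \<oplus>\<^bsub>?R\<^esub> b \<ominus>\<^bsub>?R\<^esub> a)"
        using mem by algebra
      finally show ?thesis ..
    qed
    then show ?case using mem by (simp add: dihedral_quandle_def two)
  qed (simp add: dihedral_quandle_def two)
qed

lemma (in ring) group_affine_group: "group (affine_group R)"
proof -
  have comp: "compose (carrier R) (affine_map R a b) (affine_map R c d) =
      affine_map R (a \<otimes> c) ((a \<otimes> d) \<oplus> b)"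
    if "a \<in> carrier R" "b \<in> carrier R" "c \<in> carrier R" "d \<in> carrier R" for a b c d
    using that by (auto simp: compose_def affine_map_def fun_eq_iff r_distr m_assoc a_assoc)
  have one: "affine_map R \<one> \<zero> = (\<lambda>x\<in>carrier R. x)"
    by (auto simp: affine_map_def fun_eq_iff)
  have inv: "compose (carrier R) (affine_map R (inv a) (\<ominus> (inv a \<otimes> b))) (affine_map R a b)
        = (\<lambda>x\<in>carrier R. x)"
      "compose (carrier R) (affine_map R a b) (affine_map R (inv a) (\<ominus> (inv a \<otimes> b)))
        = (\<lambda>x\<in>carrier R. x)"
    if "a \<in> Units R" "b \<in> carrier R" for a b
    using that
    by (simp_all add: comp one [symmetric] Units_closed Units_l_inv Units_r_inv r_minus
        m_assoc [symmetric] r_neg l_neg)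
  have clos: "affine_map R a b \<in> carrier R \<rightarrow> carrier R"
    if "a \<in> carrier R" "b \<in> carrier R" for a b
    using that by (auto simp: affine_map_def)
  have bij: "affine_map R a b \<in> Bij (carrier R)" if "a \<in> Units R" "b \<in> carrier R" for a b
  proof -
    let ?g = "affine_map R (inv a) (\<ominus> (inv a \<otimes> b))"
    have "bij_betw (affine_map R a b) (carrier R) (carrier R)"
    proof (rule bij_betwI)
      show "affine_map R a b \<in> carrier R \<rightarrow> carrier R" "?g \<in> carrier R \<rightarrow> carrier R"
        by (rule clos; use that in \<open>simp add: Units_closed\<close>)+
    next
      fix x assume "x \<in> carrier R"
      then show "?g (affine_map R a b x) = x" "affine_map R a b (?g x) = x"
        using fun_cong [OF inv(1) [OF that], of x] fun_cong [OF inv(2) [OF that], of x]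
        by (simp_all add: compose_eq)
    qed
    then show ?thesis by (simp add: Bij_def affine_map_def)
  qed
  let ?A = "{affine_map R a b | a b. a \<in> Units R \<and> b \<in> carrier R}"
  show ?thesis
  proof (rule groupI)
    fix f g assume "f \<in> carrier (affine_group R)" "g \<in> carrier (affine_group R)"
    then obtain a b c d where "f = affine_map R a b" "g = affine_map R c d"
      "a \<in> Units R" "b \<in> carrier R" "c \<in> Units R" "d \<in> carrier R"
      by (auto simp: affine_group_def)
    then show "f \<otimes>\<^bsub>affine_group R\<^esub> g \<in> carrier (affine_group R)"
      by (simp add: affine_group_def BijGroup_def bij comp Units_closed)
         (blast intro: Units_closed Units_m_closed a_closed m_closed)
  next
    have "affine_map R \<one> \<zero> \<in> ?A" by blast
    then show "\<one>\<^bsub>affine_group R\<^esub> \<in> carrier (affine_group R)"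
      by (simp add: affine_group_def BijGroup_def one)
  next
    fix f g h assume "f \<in> carrier (affine_group R)" "g \<in> carrier (affine_group R)"
      "h \<in> carrier (affine_group R)"
    then have "f \<in> carrier (BijGroup (carrier R))" "g \<in> carrier (BijGroup (carrier R))"
      "h \<in> carrier (BijGroup (carrier R))"
      by (auto simp: affine_group_def BijGroup_def bij)
    then show "f \<otimes>\<^bsub>affine_group R\<^esub> g \<otimes>\<^bsub>affine_group R\<^esub> h =
        f \<otimes>\<^bsub>affine_group R\<^esub> (g \<otimes>\<^bsub>affine_group R\<^esub> h)"
      using monoid.m_assoc [OF group.is_monoid [OF group_BijGroup]]
      by (simp add: affine_group_def)
  next
    fix f assume "f \<in> carrier (affine_group R)"
    then have "f \<in> carrier (BijGroup (carrier R))"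
      by (auto simp: affine_group_def BijGroup_def bij)
    then show "\<one>\<^bsub>affine_group R\<^esub> \<otimes>\<^bsub>affine_group R\<^esub> f = f"
      using monoid.l_one [OF group.is_monoid [OF group_BijGroup]]
      by (simp add: affine_group_def)
  next
    fix f assume "f \<in> carrier (affine_group R)"
    then obtain a b where f: "f = affine_map R a b" "a \<in> Units R" "b \<in> carrier R"
      by (auto simp: affine_group_def)
    let ?g = "affine_map R (inv a) (\<ominus> (inv a \<otimes> b))"
    have "inv a \<in> Units R" "\<ominus> (inv a \<otimes> b) \<in> carrier R"
      using f by auto
    then have "?g \<in> carrier (affine_group R)"
      by (auto simp: affine_group_def)
    moreover have "?g \<otimes>\<^bsub>affine_group R\<^esub> f = \<one>\<^bsub>affine_group R\<^esub>"
      using f inv(1) by (simp add: affine_group_def BijGroup_def bij)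
    ultimately show "\<exists>g\<in>carrier (affine_group R). g \<otimes>\<^bsub>affine_group R\<^esub> f = \<one>\<^bsub>affine_group R\<^esub>"
      by blast
  qed
qed

end

theory Submission
  imports Defs
begin

text \<open>Along the multiples of \<open>1\<close> a dihedral homomorphism \<open>f\<close> satisfies the second-order recursion
  \<open>f (k + 2) = 2 f (k + 1) - f k\<close>, whose solutions are the arithmetic progressions; so \<open>f\<close> is
  the affine map with slope \<open>f 1 - f 0\<close>, and surjectivity forces the slope to be a unit.  The two
  groups therefore have the same carrier inside the symmetric group of \<open>\<int>/n\<close>.\<close>

lemma (in cring) affine_map_Bij:
  assumes a: "a \<in> Units R" and b: "b \<in> carrier R"
  shows "affine_map R a b \<in> Bij (carrier R)"
proof -
  have aR: "a \<in> carrier R" and iR: "inv a \<in> carrier R"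
    using a by auto
  have "bij_betw (affine_map R a b) (carrier R) (carrier R)"
  proof (rule bij_betwI [where g = "\<lambda>y. inv a \<otimes> (y \<ominus> b)"])
    fix x assume x: "x \<in> carrier R"
    \<comment> \<open>To \<open>algebra\<close>, \<open>inv a\<close> is just another ring element,
      so \<open>inv a\<close> and \<open>a\<close> are first brought together and cancelled
      afterwards by the unit law.\<close>
    have "inv a \<otimes> (a \<otimes> x \<oplus> b \<ominus> b) = (inv a \<otimes> a) \<otimes> x"
      using x aR iR b by algebra
    then show "inv a \<otimes> (affine_map R a b x \<ominus> b) = x"
      using x a by (simp add: affine_map_def Units_l_inv)
    have "a \<otimes> (inv a \<otimes> (x \<ominus> b)) \<oplus> b = (a \<otimes> inv a) \<otimes> (x \<ominus> b) \<oplus> b"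
      using x aR iR b by algebra
    also have "\<dots> = (x \<ominus> b) \<oplus> b"
      using x a b by (simp add: Units_r_inv)
    also have "\<dots> = x"
      using x b by algebra
    finally show "affine_map R a b (inv a \<otimes> (x \<ominus> b)) = x"
      using x iR b by (simp add: affine_map_def)
  qed (use aR iR b in \<open>auto simp: affine_map_def\<close>)
  then show ?thesis
    by (simp add: Bij_def affine_map_def)
qed

text \<open>The coefficients in \<open>y + y - x\<close> sum to 1, so the constant term
  \<open>b\<close> comes out exactly once on the right, as \<open>b + b - b\<close>.\<close>

lemma (in cring) affine_map_reflection:
  assumes "a \<in> carrier R" "b \<in> carrier R" "x \<in> carrier R" "y \<in> carrier R"
  shows "affine_map R a b (y \<oplus> y \<ominus> x)
    = affine_map R a b y \<oplus> affine_map R a b y \<ominus> affine_map R a b x"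
proof -
  have "a \<otimes> (y \<oplus> y \<ominus> x) \<oplus> b = (a \<otimes> y \<oplus> b) \<oplus> (a \<otimes> y \<oplus> b) \<ominus> (a \<otimes> x \<oplus> b)"
    using assms by algebra
  then show ?thesis
    using assms by (simp add: affine_map_def)
qed

lemma (in cring) reflection_hom_add_pow_one:
  fixes k :: nat
  assumes f: "f \<in> carrier R \<rightarrow> carrier R"
    and refl: "\<And>x y. \<lbrakk>x \<in> carrier R; y \<in> carrier R\<rbrakk> \<Longrightarrow> f (y \<oplus> y \<ominus> x) = f y \<oplus> f y \<ominus> f x"
  shows "f ([k] \<cdot> \<one>) = (f \<one> \<ominus> f \<zero>) \<otimes> [k] \<cdot> \<one> \<oplus> f \<zero>"
proof -
  have f01: "f \<zero> \<in> carrier R" "f \<one> \<in> carrier R"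
    using f by auto
  show ?thesis
  \<comment> \<open>A second-order recursion needs two initial values; slope and intercept are
    chosen to make the formula hold at 0 and 1.\<close>
  proof (induction k rule: induct_nat_012)
    case 0
    have "f \<zero> = (f \<one> \<ominus> f \<zero>) \<otimes> \<zero> \<oplus> f \<zero>"
      using f01 by algebra
    then show ?case by simp
  next
    case 1
    have "f \<one> = (f \<one> \<ominus> f \<zero>) \<otimes> \<one> \<oplus> f \<zero>"
      using f01 by algebra
    then show ?case by simp
  next
    case (ge2 k)
    define u where "u = [k] \<cdot> \<one>"
    have u: "u \<in> carrier R"
      by (simp add: u_def)
    have fu: "f u = (f \<one> \<ominus> f \<zero>) \<otimes> u \<oplus> f \<zero>"
      and fu1: "f (u \<oplus> \<one>) = (f \<one> \<ominus> f \<zero>) \<otimes> (u \<oplus> \<one>) \<oplus> f \<zero>"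
      using ge2 by (simp_all add: u_def)
    \<comment> \<open>The next multiple of \<open>\<one>\<close> is the reflection of
      \<open>u\<close> in \<open>u + 1\<close>, so \<open>refl\<close> expresses its image through
      the two values already known.\<close>
    have "u \<oplus> \<one> \<oplus> \<one> = (u \<oplus> \<one>) \<oplus> (u \<oplus> \<one>) \<ominus> u"
      using u by algebra
    then have "f (u \<oplus> \<one> \<oplus> \<one>) = f (u \<oplus> \<one>) \<oplus> f (u \<oplus> \<one>) \<ominus> f u"
      using refl [of u "u \<oplus> \<one>"] u by simp
    also have "\<dots> = (f \<one> \<ominus> f \<zero>) \<otimes> (u \<oplus> \<one> \<oplus> \<one>) \<oplus> f \<zero>"
      unfolding fu fu1 using u f01 by algebra
    finally show ?case
      by (simp add: u_def)
  qed
qed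

lemma (in cring) affine_map_surj_imp_Units:
  assumes a: "a \<in> carrier R" and b: "b \<in> carrier R"
    and surj: "affine_map R a b ` carrier R = carrier R"
  shows "a \<in> Units R"
proof -
  \<comment> \<open>A preimage of \<open>1 + b\<close> solves \<open>a x = 1\<close>, hence is the
    inverse of \<open>a\<close>.\<close>
  have "\<one> \<oplus> b \<in> affine_map R a b ` carrier R"
    using surj b by simp
  then obtain x where x: "x \<in> carrier R" "a \<otimes> x \<oplus> b = \<one> \<oplus> b"
    by (auto simp: affine_map_def)
  then have "a \<otimes> x = \<one>"
    using a b by simp
  moreover from this have "x \<otimes> a = \<one>"
    using a x by (simp add: m_comm)
  ultimately show ?thesis
    using a x(1) by (auto simp: Units_def)
qed

text \<open>The hypothesis \<open>cyclic\<close> is what carries the formula for \<open>f\<close>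
  from the multiples of \<open>\<one>\<close> to the whole ring. It speaks of natural multiples
  because the induction only runs upwards.\<close>

lemma (in cring) reflection_Bij_eq_affine:
  assumes cyclic: "carrier R \<subseteq> range (\<lambda>k::nat. [k] \<cdot> \<one>)"
  shows "{f \<in> Bij (carrier R). \<forall>x\<in>carrier R. \<forall>y\<in>carrier R. f (y \<oplus> y \<ominus> x) = f y \<oplus> f y \<ominus> f x}
    = {affine_map R a b | a b. a \<in> Units R \<and> b \<in> carrier R}" (is "?B = ?A")
proof
  show "?A \<subseteq> ?B"
    by (auto simp: affine_map_Bij affine_map_reflection)
  show "?B \<subseteq> ?A"
  proof
    fix f assume "f \<in> ?B"
    then have bij: "bij_betw f (carrier R) (carrier R)" and ext: "f \<in> extensional (carrier R)"
      and refl: "\<And>x y. \<lbrakk>x \<in> carrier R; y \<in> carrier R\<rbrakk> \<Longrightarrow> f (y \<oplus> y \<ominus> x) = f y \<oplus> f y \<ominus> f x"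
      by (auto simp: Bij_def)
    have f: "f \<in> carrier R \<rightarrow> carrier R"
      using bij by (rule bij_betw_imp_funcset)
    define a where "a = f \<one> \<ominus> f \<zero>"
    have mem: "a \<in> carrier R" "f \<zero> \<in> carrier R"
      using f by (auto simp: a_def)
    have eq: "f = affine_map R a (f \<zero>)"
    proof (rule extensionalityI [OF ext])
      fix x assume x: "x \<in> carrier R"
      then obtain k :: nat where "x = [k] \<cdot> \<one>"
        using cyclic by auto
      then show "f x = affine_map R a (f \<zero>) x"
        using reflection_hom_add_pow_one [where f = f and k = k, OF f refl] x
        by (simp add: affine_map_def a_def)
    qed (simp add: affine_map_def)
    have "a \<in> Units R"
      using affine_map_surj_imp_Units [OF mem] bij eq by (simp add: bij_betw_def)
    with eq mem show "f \<in> ?A" by blast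
  qed
qed

text \<open>The quotient map from the integers is a ring homomorphism, so it sends a natural number
  k to the k-fold sum of \<open>\<one>\<close>, and for positive \<open>n\<close> every class has a
  natural representative. For \<open>n = 0\<close> the quotient is a copy of the integers, and
  negative elements would be missed.\<close>

lemma carrier_ZFact_subset_add_pow_one:
  assumes "n > 0"
  shows "carrier (ZFact (int n)) \<subseteq> range (\<lambda>k::nat. [k] \<cdot>\<^bsub>ZFact (int n)\<^esub> \<one>\<^bsub>ZFact (int n)\<^esub>)"
proof
  let ?R = "ZFact (int n)" and ?I = "Idl\<^bsub>\<Z>\<^esub> {int n}"
  interpret R: cring ?R by (rule ZFact_is_cring)
  interpret I: ideal ?I \<Z>
    by (rule int.genideal_ideal) simp
  interpret h: ring_hom_ring \<Z> ?R "\<lambda>z. ?I +>\<^bsub>\<Z>\<^esub> z"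
    unfolding ZFact_def by (rule I.rcos_ring_hom_ring)
  have pow: "?I +>\<^bsub>\<Z>\<^esub> int k = [k] \<cdot>\<^bsub>?R\<^esub> \<one>\<^bsub>?R\<^esub>" for k
  proof (induction k)
    case 0
    show ?case using h.hom_zero by simp
  next
    case (Suc k)
    then show ?case
      using h.hom_add [of "int k" 1] h.hom_one by (simp add: add.commute)
  qed
  fix x assume "x \<in> carrier ?R"
  then obtain z where "x = ?I +>\<^bsub>\<Z>\<^esub> z"
    unfolding ZFact_def FactRing_def A_RCOSETS_def' by auto
  \<comment> \<open>The remainder lies in the same class as \<open>z\<close> and is nonnegative,
    which makes \<open>pow\<close> applicable.\<close>
  also have "\<dots> = ?I +>\<^bsub>\<Z>\<^esub> (z mod int n)"
    using ZMod_mod [of "int n" z] unfolding ZMod_def .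
  also have "z mod int n = int (nat (z mod int n))"
    using assms by simp
  also note pow
  finally show "x \<in> range (\<lambda>k::nat. [k] \<cdot>\<^bsub>?R\<^esub> \<one>\<^bsub>?R\<^esub>)"
    by (rule range_eqI)
qed

theorem theorem2p1:
  fixes n :: nat
  assumes "n > 0"
  shows "quandle_Aut (dihedral_quandle n) \<cong> affine_group (ZFact (int n))"
proof -
  let ?R = "ZFact (int n)" and ?Q = "dihedral_quandle n"
  interpret R: cring ?R by (rule ZFact_is_cring)
  \<comment> \<open>The double of \<open>y\<close> unfolds to \<open>y + y\<close>, and a bijection
    of the carrier already maps it into itself, so only the reflection identity remains.\<close>
  have "quandle_hom ?Q ?Q \<inter> Bij (carrier ?Q) = {f \<in> Bij (carrier ?R).
      \<forall>x\<in>carrier ?R. \<forall>y\<in>carrier ?R. f (y \<oplus>\<^bsub>?R\<^esub> y \<ominus>\<^bsub>?R\<^esub> x) = f y \<oplus>\<^bsub>?R\<^esub> f y \<ominus>\<^bsub>?R\<^esub> f x}"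
    by (auto simp: quandle_hom_def dihedral_quandle_def numeral_2_eq_2 Bij_def
        dest: bij_betw_imp_funcset bij_betw_apply)
  also have "\<dots> = {affine_map ?R a b | a b. a \<in> Units ?R \<and> b \<in> carrier ?R}"
    by (rule R.reflection_Bij_eq_affine [OF carrier_ZFact_subset_add_pow_one [OF assms]])
  \<comment> \<open>Both groups inherit product and unit from the same \<open>BijGroup\<close>, so
    equal carriers make them equal, and the identity is the isomorphism.\<close>
  finally have "quandle_Aut ?Q = affine_group ?R"
    by (simp add: quandle_Aut_def affine_group_def dihedral_quandle_def)
  then show ?thesis
    using iso_refl by simp
qed

end
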